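(* Let $\mathcal{E}$ be a compatible coarse structure on a group $G$. Let $\pi_G\colon G\times G\to G$ be the shear map $\pi_G(x,y)=y^{-1}x$. Define $\mathcal{F}(\mathcal{E})=\{\pi_G(E) : E\in\mathcal{E}\}$. Then $\mathcal{F}(\mathcal{E})$ is a generating family on $G$, and $\mathcal{E}=\mathcal{E}_{\mathcal{F}(\mathcal{E})}$.
   Context: For subsets $A,B$ of $G$: $AB=\{ab : a\in A, b\in B\}$, $A^{-1}=\{a^{-1} : a\in A\}$. For $E\subset G\times G$, $GE=\{(ga,gb) : g\in G,\ (a,b)\in E\}$; $E$ is $G$-invariant if $GE=E$. A generating family on $G$ is a family $\mathcal{F}$ of subsets of $G$ such that: (a) some $A\in\mathcal{F}$ is non-empty; (b) a finite union of elements of $\mathcal{F}$ is in $\mathcal{F}$; (c) if $A,B\in\mathcal{F}$ then $AB\in\mathcal{F}$; (d) if $A\in\mathcal{F}$ then $A^{-1}\in\mathcal{F}$. For a generating family $\mathcal{F}$, $\mathcal{E}_{\mathcal{F}}=\{E\subset G\times G : \exists A\in\mathcal{F},\ E\subset G(A\times A)\}$. A coarse structure on a set $X$ is a collection $\mathcal{E}$ of subsets of $X\times X$ (entourages) such that: the diagonal is an entourage; subsets of entourages are entourages; finite unions of entourages are entourages; the inverse $E^{-1}=\{(y,x) : (x,y)\in E\}$ of an entourage is an entourage; and the composition $E_1\circ E_2=\{(x,z) : \exists y\in X,\ (x,y)\in E_1\text{ and }(y,z)\in E_2\}$ of two entourages is an entourage. A coarse structure on a group $G$ is compatible if every entourage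 is contained in a $G$-invariant entourage. *)

theory Defs
  imports "HOL-Algebra.Coset"
begin

definition coarse_structure :: "'a set \<Rightarrow> ('a \<times> 'a) set set \<Rightarrow> bool" where
  "coarse_structure X \<E> \<longleftrightarrow>
     (\<forall>E\<in>\<E>. E \<subseteq> X \<times> X) \<and>
     Id_on X \<in> \<E> \<and>
     (\<forall>E\<in>\<E>. \<forall>D. D \<subseteq> E \<longrightarrow> D \<in> \<E>) \<and>
     (\<forall>\<D>. finite \<D> \<and> \<D> \<subseteq> \<E> \<longrightarrow> \<Union>\<D> \<in> \<E>) \<and>
     (\<forall>E\<in>\<E>. E\<inverse> \<in> \<E>) \<and>
     (\<forall>E1\<in>\<E>. \<forall>E2\<in>\<E>. E1 O E2 \<in> \<E>)"

definition translates :: "('a, 'b) monoid_scheme \<Rightarrow> ('a \<times> 'a) set \<Rightarrow> ('a \<times> 'a) set" where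
  "translates G E = {(g \<otimes>\<^bsub>G\<^esub> a, g \<otimes>\<^bsub>G\<^esub> b) | g a b. g \<in> carrier G \<and> (a, b) \<in> E}"

definition invariant :: "('a, 'b) monoid_scheme \<Rightarrow> ('a \<times> 'a) set \<Rightarrow> bool" where
  "invariant G E \<longleftrightarrow> translates G E = E"

definition compatible_coarse_structure ::
    "('a, 'b) monoid_scheme \<Rightarrow> ('a \<times> 'a) set set \<Rightarrow> bool" where
  "compatible_coarse_structure G \<E> \<longleftrightarrow>
     coarse_structure (carrier G) \<E> \<and>
     (\<forall>E\<in>\<E>. \<exists>D\<in>\<E>. invariant G D \<and> E \<subseteq> D)"

text \<open>As for coarse structures, finite unions include the empty union, so a generating
  family contains the empty set.\<close>

definition generating_family :: "('a, 'b) monoid_scheme \<Rightarrow> 'a set set \<Rightarrow> bool" where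
  "generating_family G \<F> \<longleftrightarrow>
     (\<forall>A\<in>\<F>. A \<subseteq> carrier G) \<and>
     (\<exists>A\<in>\<F>. A \<noteq> {}) \<and>
     (\<forall>\<A>. finite \<A> \<and> \<A> \<subseteq> \<F> \<longrightarrow> \<Union>\<A> \<in> \<F>) \<and>
     (\<forall>A\<in>\<F>. \<forall>B\<in>\<F>. A <#>\<^bsub>G\<^esub> B \<in> \<F>) \<and>
     (\<forall>A\<in>\<F>. set_inv\<^bsub>G\<^esub> A \<in> \<F>)"

definition family_entourages ::
    "('a, 'b) monoid_scheme \<Rightarrow> 'a set set \<Rightarrow> ('a \<times> 'a) set set" where
  "family_entourages G \<F> =
     {E. E \<subseteq> carrier G \<times> carrier G \<and> (\<exists>A\<in>\<F>. E \<subseteq> translates G (A \<times> A))}"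

definition shear :: "('a, 'b) monoid_scheme \<Rightarrow> 'a \<times> 'a \<Rightarrow> 'a" where
  "shear G = (\<lambda>(x, y). inv\<^bsub>G\<^esub> y \<otimes>\<^bsub>G\<^esub> x)"

definition shear_family ::
    "('a, 'b) monoid_scheme \<Rightarrow> ('a \<times> 'a) set set \<Rightarrow> 'a set set" where
  "shear_family G \<E> = {shear G ` E | E. E \<in> \<E>}"

end

theory Submission imports Defs begin

text \<open>A set lies in the family of shear images of a compatible coarse structure iff
  its product with the singleton of the unit is an entourage: translating an element
  \<open>(x, y)\<close> of an invariant entourage by \<open>y\<^sup>-\<^sup>1\<close> yields \<open>(y\<^sup>-\<^sup>1x, 1)\<close>. All
  closure properties are then read off at the unit.\<close>

lemma coarse_structureD:
  assumes "coarse_structure X \<E>"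
  shows coarse_structure_subset: "E \<in> \<E> \<Longrightarrow> E \<subseteq> X \<times> X"
    and coarse_structure_Id_on: "Id_on X \<in> \<E>"
    and coarse_structure_mono: "E \<in> \<E> \<Longrightarrow> D \<subseteq> E \<Longrightarrow> D \<in> \<E>"
    and coarse_structure_Union: "finite \<D> \<Longrightarrow> \<D> \<subseteq> \<E> \<Longrightarrow> \<Union>\<D> \<in> \<E>"
    and coarse_structure_converse: "E \<in> \<E> \<Longrightarrow> E\<inverse> \<in> \<E>"
    and coarse_structure_relcomp: "E \<in> \<E> \<Longrightarrow> D \<in> \<E> \<Longrightarrow> E O D \<in> \<E>"
  using assms unfolding coarse_structure_def by blast+

lemma invariant_translate:
  assumes "invariant G D" "(a, b) \<in> D" "g \<in> carrier G"
  shows "(g \<otimes>\<^bsub>G\<^esub> a, g \<otimes>\<^bsub>G\<^esub> b) \<in> D"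
  using assms unfolding invariant_def translates_def by blast

text \<open>The axioms of a coarse structure alone do not make the union of all translates of an
  entourage an entourage. Compatibility puts an invariant entourage \<open>D\<close> above
  \<open>E\<close>, and invariance traps every translate of \<open>E\<close> inside
  \<open>D\<close>.\<close>

lemma translates_subset_invariant:
  assumes "invariant G D" "E \<subseteq> D"
  shows "translates G E \<subseteq> D"
  using assms unfolding invariant_def translates_def by blast

lemma (in group) mem_shear_family_iff:
  assumes "compatible_coarse_structure G \<E>"
  shows "A \<in> shear_family G \<E> \<longleftrightarrow> A \<subseteq> carrier G \<and> A \<times> {\<one>} \<in> \<E>"
proof
  have cs: "coarse_structure (carrier G) \<E>"
    using assms unfolding compatible_coarse_structure_def by blast
  assume "A \<in> shear_family G \<E>"
  then obtain E where E: "E \<in> \<E>" "A = shear G ` E"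
    unfolding shear_family_def by blast
  have sub: "E \<subseteq> carrier G \<times> carrier G"
    using coarse_structure_subset[OF cs E(1)] .
  obtain D where D: "D \<in> \<E>" "invariant G D" "E \<subseteq> D"
    using assms E(1) unfolding compatible_coarse_structure_def by blast
  have "(shear G (x, y), \<one>) \<in> D" if "(x, y) \<in> E" for x y
  proof -
    have "y \<in> carrier G" using that sub by blast
    then show ?thesis
      using invariant_translate[OF D(2), of x y "inv y"] that D(3)
      by (auto simp: shear_def)
  qed
  then have "A \<times> {\<one>} \<subseteq> D" using E(2) by auto
  moreover have "A \<subseteq> carrier G" using E(2) sub by (auto simp: shear_def)
  ultimately show "A \<subseteq> carrier G \<and> A \<times> {\<one>} \<in> \<E>"
    using coarse_structure_mono[OF cs D(1)] by blast
next
  assume A: "A \<subseteq> carrier G \<and> A \<times> {\<one>} \<in> \<E>"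
  \<comment> \<open>The slice \<open>A \<times> {\<one>}\<close> itself serves as the entourage with
    image \<open>A\<close>: on it the shear map is the first projection.\<close>
  have "shear G (x, \<one>) = x" if "x \<in> A" for x
    using A that by (auto simp: shear_def)
  then have "shear G ` (A \<times> {\<one>}) = A" by force
  then show "A \<in> shear_family G \<E>"
    using A unfolding shear_family_def by blast
qed

lemma (in group) generating_family_shear_family:
  assumes "compatible_coarse_structure G \<E>"
  shows "generating_family G (shear_family G \<E>)"
proof -
  note iff = mem_shear_family_iff[OF assms]
  have cs: "coarse_structure (carrier G) \<E>"
    and inv_ex: "\<And>E. E \<in> \<E> \<Longrightarrow> \<exists>D\<in>\<E>. invariant G D \<and> E \<subseteq> D"
    using assms unfolding compatible_coarse_structure_def by blast+
  have ne: "{\<one>} \<in> shear_family G \<E>"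
    unfolding iff
    using coarse_structure_mono[OF cs coarse_structure_Id_on[OF cs], of "{\<one>} \<times> {\<one>}"]
    by auto
  have un: "\<Union>\<A> \<in> shear_family G \<E>"
    if \<A>: "finite \<A>" "\<A> \<subseteq> shear_family G \<E>" for \<A>
  proof -
    \<comment> \<open>Slicing at the unit commutes with unions, so no preimages under
      \<open>shear\<close> have to be chosen for the members of \<open>\<A>\<close>.\<close>
    have "\<Union>((\<lambda>A. A \<times> {\<one>}) ` \<A>) \<in> \<E>"
      using \<A> iff by (intro coarse_structure_Union[OF cs]) auto
    also have "\<Union>((\<lambda>A. A \<times> {\<one>}) ` \<A>) = \<Union>\<A> \<times> {\<one>}" by blast
    finally show ?thesis using \<A>(2) iff by blast
  qed
  have mult: "A <#> B \<in> shear_family G \<E>"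
    if AB: "A \<in> shear_family G \<E>" "B \<in> shear_family G \<E>" for A B
  proof -
    have A: "A \<subseteq> carrier G" "A \<times> {\<one>} \<in> \<E>" and B: "B \<subseteq> carrier G" "B \<times> {\<one>} \<in> \<E>"
      using AB iff by auto
    obtain D where D: "D \<in> \<E>" "invariant G D" "B \<times> {\<one>} \<subseteq> D"
      using inv_ex[OF B(2)] by blast
    \<comment> \<open>Translating \<open>(b, \<one>)\<close> by \<open>a\<close> moves its second
      entry to \<open>a\<close>, where it meets the first entry of \<open>(a, \<one>)\<close>; the
      composition then joins \<open>a \<otimes> b\<close> to \<open>\<one>\<close>. The translated
      pairs stay in one entourage because \<open>D\<close> is invariant.\<close>
    have "(a \<otimes> b, a) \<in> D" if "a \<in> A" "b \<in> B" for a b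
      using invariant_translate[OF D(2), of b \<one> a] that D(3) A(1) by auto
    then have "(A <#> B) \<times> {\<one>} \<subseteq> D O (A \<times> {\<one>})"
      unfolding set_mult_def by blast
    then have "(A <#> B) \<times> {\<one>} \<in> \<E>"
      using coarse_structure_mono[OF cs coarse_structure_relcomp[OF cs D(1) A(2)]] by blast
    then show ?thesis using iff set_mult_closed[OF A(1) B(1)] by blast
  qed
  have inverse: "set_inv A \<in> shear_family G \<E>" if "A \<in> shear_family G \<E>" for A
  proof -
    have A: "A \<subseteq> carrier G" "A \<times> {\<one>} \<in> \<E>" using that iff by auto
    obtain D where D: "D \<in> \<E>" "invariant G D" "A \<times> {\<one>} \<subseteq> D"
      using inv_ex[OF A(2)] by blast
    \<comment> \<open>This pair is the translate of \<open>(a, \<one>)\<close> by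
      \<open>inv a\<close>; the converse of \<open>D\<close> turns it into the slice pair
      \<open>(inv a, \<one>)\<close>.\<close>
    have "(\<one>, inv a) \<in> D" if "a \<in> A" for a
    proof -
      have "a \<in> carrier G" using that A(1) by blast
      then show ?thesis
        using invariant_translate[OF D(2), of a \<one> "inv a"] that D(3) by auto
    qed
    then have "(set_inv A) \<times> {\<one>} \<subseteq> D\<inverse>" by (auto simp: SET_INV_def)
    then have "(set_inv A) \<times> {\<one>} \<in> \<E>"
      using coarse_structure_mono[OF cs coarse_structure_converse[OF cs D(1)]] by blast
    moreover have "set_inv A \<subseteq> carrier G" using A(1) by (auto simp: SET_INV_def)
    ultimately show ?thesis using iff by blast
  qed
  show ?thesis
    unfolding generating_family_def
  proof (intro conjI)
    show "\<forall>A\<in>shear_family G \<E>. A \<subseteq> carrier G" using iff by blast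
    show "\<exists>A\<in>shear_family G \<E>. A \<noteq> {}" using ne by blast
  qed (use un mult inverse in simp_all)
qed

lemma (in group) family_entourages_shear_family:
  assumes "compatible_coarse_structure G \<E>"
  shows "family_entourages G (shear_family G \<E>) = \<E>"
proof (intro equalityI subsetI)
  note iff = mem_shear_family_iff[OF assms]
  have cs: "coarse_structure (carrier G) \<E>"
    using assms unfolding compatible_coarse_structure_def by blast
  fix E assume "E \<in> family_entourages G (shear_family G \<E>)"
  then obtain A where A: "A \<times> {\<one>} \<in> \<E>" and E: "E \<subseteq> translates G (A \<times> A)"
    unfolding family_entourages_def using iff by blast
  \<comment> \<open>Any two elements of \<open>A\<close> are joined by a path through the unit, so
    the slice already controls the whole square.\<close>
  have "A \<times> A = (A \<times> {\<one>}) O (A \<times> {\<one>})\<inverse>" by auto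
  then have "A \<times> A \<in> \<E>"
    using coarse_structure_relcomp[OF cs A coarse_structure_converse[OF cs A]] by simp
  then obtain D where D: "D \<in> \<E>" "invariant G D" "A \<times> A \<subseteq> D"
    using assms unfolding compatible_coarse_structure_def by blast
  then show "E \<in> \<E>"
    using coarse_structure_mono[OF cs D(1)] translates_subset_invariant[OF D(2,3)] E by blast
next
  have cs: "coarse_structure (carrier G) \<E>"
    using assms unfolding compatible_coarse_structure_def by blast
  fix E assume E: "E \<in> \<E>"
  \<comment> \<open>The diagonal is adjoined only to force \<open>\<one>\<close> into
    \<open>?A\<close>: the pairs to be translated have second entry \<open>\<one>\<close>, which the
    shear image of \<open>E\<close> alone may miss.\<close>
  let ?A = "shear G ` (E \<union> Id_on (carrier G))"
  have sub: "E \<subseteq> carrier G \<times> carrier G"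
    using coarse_structure_subset[OF cs E] .
  have "E \<union> Id_on (carrier G) \<in> \<E>"
    using coarse_structure_Union[OF cs, of "{E, Id_on (carrier G)}"] E
      coarse_structure_Id_on[OF cs] by simp
  then have A: "?A \<in> shear_family G \<E>" unfolding shear_family_def by blast
  have "shear G (\<one>, \<one>) = \<one>" by (simp add: shear_def)
  then have one: "\<one> \<in> ?A" by (metis Id_onI UnI2 image_eqI one_closed)
  have "(x, y) \<in> translates G (?A \<times> ?A)" if "(x, y) \<in> E" for x y
  proof -
    have xy: "x \<in> carrier G" "y \<in> carrier G" using that sub by auto
    \<comment> \<open>Translation by \<open>y\<close> undoes the translation by \<open>inv y\<close>
      that brought the pair to the unit slice in \<open>mem_shear_family_iff\<close>.\<close>
    then have "(x, y) = (y \<otimes> shear G (x, y), y \<otimes> \<one>)"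
      by (simp add: shear_def flip: m_assoc)
    moreover have "(shear G (x, y), \<one>) \<in> ?A \<times> ?A" using that one by blast
    ultimately show ?thesis using xy(2) unfolding translates_def by blast
  qed
  then have "E \<subseteq> translates G (?A \<times> ?A)" by auto
  then show "E \<in> family_entourages G (shear_family G \<E>)"
    using A sub unfolding family_entourages_def by blast
qed

theorem proposition2p5:
  fixes G :: "('a, 'b) monoid_scheme" and \<E> :: "('a \<times> 'a) set set"
  assumes "group G"
    and "compatible_coarse_structure G \<E>"
  shows "generating_family G (shear_family G \<E>) \<and>
         \<E> = family_entourages G (shear_family G \<E>)"
  using group.generating_family_shear_family[OF assms]
    group.family_entourages_shear_family[OF assms] by simp

end
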